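(* For every computable simulation $\alpha$ of $A^\ast$, the set $\{\alpha(\phi)\mid\phi\text{ is an }\mathcal{L}\text{-sentence and }\mathbb{N}\models\phi\}$ is not arithmetical.
   Context: Language: $\mathcal{L}$ is the first-order arithmetical language with symbols $\mathsf{0},\mathsf{S},+,\times,=,\neg,\wedge,\forall$; $\mathbb{N}$ also denotes its standard interpretation. The finite alphabet $A$ consists of these symbols together with $\mathsf{v}$, $\prime$, $($ and $)$. $A^\ast$ is the set of nonempty finite strings over $A$, with concatenation $\ast$. Variables are $\mathsf{v}$ followed by finitely many strokes; terms and formulae are the usual well-formed (fully parenthesised, infix) strings in $A^\ast$. A numbering of $A^\ast$ is an injective function $\alpha\colon A^\ast\to\mathbb{N}$. Let $G=\alpha(A^\ast)$ and let $\circledast_\alpha\colon G\times G\to G$ be $\circledast_\alpha(m,n)=\alpha(\alpha^{-1}(m)\ast\alpha^{-1}(n))$. $\alpha$ is a computable simulation of $A^\ast$ if $G$ is decidable and $\circledast_\alpha$ is recursive (i.e. a partial recursive function with decidable domain $G\times G$). A set of natural numbers is arithmetical if it is definable in $\mathbb{N}$ by an $\mathcal{L}$-formula. *)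

theory Defs
  imports Main
begin

subsection \<open>Strings over the alphabet\<close>

datatype symb =
  SZero | SSuc | SPlus | STimes | SEq | SNot | SAnd | SAll | SVar | SStroke | SLpar | SRpar

definition Astar :: "symb list set" where
  "Astar = {w. w \<noteq> []}"


subsection \<open>Terms and formulae of the language of arithmetic\<close>

text \<open>
  Terms and formulae are parse trees, and \<open>tm_str\<close>, \<open>fm_str\<close> give the strings they stand for.
  By unique readability (\<open>tm_str_inj\<close>, \<open>fm_str_inj\<close>) parse trees and well-formed strings are
  in bijection. The variable with index \<open>i\<close> is \<open>SVar\<close> followed by \<open>i\<close> strokes. Every
  application of a binary infix symbol carries its own pair of parentheses.
\<close>

datatype tm = Zero | Var nat | Succ tm | Add tm tm | Mult tm tm

datatype fm = Eq tm tm | Neg fm | Conj fm fm | Forall nat fm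

definition var_str :: "nat \<Rightarrow> symb list" where
  "var_str i = SVar # replicate i SStroke"

primrec tm_str :: "tm \<Rightarrow> symb list" where
  "tm_str Zero = [SZero]"
| "tm_str (Var i) = var_str i"
| "tm_str (Succ t) = SSuc # tm_str t"
| "tm_str (Add s t) = SLpar # tm_str s @ SPlus # tm_str t @ [SRpar]"
| "tm_str (Mult s t) = SLpar # tm_str s @ STimes # tm_str t @ [SRpar]"

primrec fm_str :: "fm \<Rightarrow> symb list" where
  "fm_str (Eq s t) = SLpar # tm_str s @ SEq # tm_str t @ [SRpar]"
| "fm_str (Neg p) = SNot # fm_str p"
| "fm_str (Conj p q) = SLpar # fm_str p @ SAnd # fm_str q @ [SRpar]"
| "fm_str (Forall i p) = SAll # var_str i @ fm_str p"

primrec tm_vars :: "tm \<Rightarrow> nat set" where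
  "tm_vars Zero = {}"
| "tm_vars (Var i) = {i}"
| "tm_vars (Succ t) = tm_vars t"
| "tm_vars (Add s t) = tm_vars s \<union> tm_vars t"
| "tm_vars (Mult s t) = tm_vars s \<union> tm_vars t"

primrec free_vars :: "fm \<Rightarrow> nat set" where
  "free_vars (Eq s t) = tm_vars s \<union> tm_vars t"
| "free_vars (Neg p) = free_vars p"
| "free_vars (Conj p q) = free_vars p \<union> free_vars q"
| "free_vars (Forall i p) = free_vars p - {i}"

definition sentence :: "fm \<Rightarrow> bool" where
  "sentence p \<longleftrightarrow> free_vars p = {}"


subsection \<open>The standard interpretation\<close>

primrec tm_val :: "(nat \<Rightarrow> nat) \<Rightarrow> tm \<Rightarrow> nat" where
  "tm_val e Zero = 0"
| "tm_val e (Var i) = e i"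
| "tm_val e (Succ t) = Suc (tm_val e t)"
| "tm_val e (Add s t) = tm_val e s + tm_val e t"
| "tm_val e (Mult s t) = tm_val e s * tm_val e t"

primrec sat :: "(nat \<Rightarrow> nat) \<Rightarrow> fm \<Rightarrow> bool" where
  "sat e (Eq s t) \<longleftrightarrow> tm_val e s = tm_val e t"
| "sat e (Neg p) \<longleftrightarrow> \<not> sat e p"
| "sat e (Conj p q) \<longleftrightarrow> sat e p \<and> sat e q"
| "sat e (Forall i p) \<longleftrightarrow> (\<forall>n. sat (e(i := n)) p)"

definition true_in_N :: "fm \<Rightarrow> bool" where
  "true_in_N p \<longleftrightarrow> (\<forall>e. sat e p)"

definition arithmetical :: "nat set \<Rightarrow> bool" where
  "arithmetical X \<longleftrightarrow>
     (\<exists>p i. free_vars p \<subseteq> {i} \<and> (\<forall>e n. n \<in> X \<longleftrightarrow> sat (e(i := n)) p))"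


subsection \<open>Partial recursive functions\<close>

text \<open>
  Programs are built from zero, successor and projections by composition, primitive
  recursion and minimisation. They carry no arity: \<open>computes c xs y\<close> says that \<open>c\<close> on the
  argument tuple \<open>xs\<close> is defined with value \<open>y\<close>. A program is undefined on tuples
  whose length does not fit. In \<open>PrimRec\<close> and \<open>Mu\<close>, the recursion variable and the search
  variable come first.
\<close>

datatype recf =
  ZeroF | SuccF | Proj nat | Comp recf "recf list" | PrimRec recf recf | Mu recf

inductive computes :: "recf \<Rightarrow> nat list \<Rightarrow> nat \<Rightarrow> bool" where
  zero: "computes ZeroF xs 0"
| succ: "computes SuccF [x] (Suc x)"
| proj: "i < length xs \<Longrightarrow> computes (Proj i) xs (xs ! i)"
| comp: "list_all2 (\<lambda>g y. computes g xs y) gs ys \<Longrightarrow> computes f ys z \<Longrightarrow>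
    computes (Comp f gs) xs z"
| primrec_0: "computes f xs y \<Longrightarrow> computes (PrimRec f g) (0 # xs) y"
| primrec_Suc: "computes (PrimRec f g) (n # xs) y \<Longrightarrow> computes g (n # y # xs) z \<Longrightarrow>
    computes (PrimRec f g) (Suc n # xs) z"
| mu: "computes f (n # xs) 0 \<Longrightarrow> (\<And>m. m < n \<Longrightarrow> \<exists>y. computes f (m # xs) (Suc y)) \<Longrightarrow>
    computes (Mu f) xs n"

definition partial_recursive :: "nat \<Rightarrow> (nat list \<Rightarrow> nat option) \<Rightarrow> bool" where
  "partial_recursive k F \<longleftrightarrow>
     (\<exists>c. \<forall>xs. length xs = k \<longrightarrow> (\<forall>y. computes c xs y \<longleftrightarrow> F xs = Some y))"

text \<open>Decidability of a \<open>k\<close>-ary relation; only the tuples of length \<open>k\<close> matter.\<close>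

definition decidable :: "nat \<Rightarrow> nat list set \<Rightarrow> bool" where
  "decidable k R \<longleftrightarrow> partial_recursive k (\<lambda>xs. Some (if xs \<in> R then 1 else 0))"

definition recursive :: "nat \<Rightarrow> (nat list \<Rightarrow> nat option) \<Rightarrow> bool" where
  "recursive k F \<longleftrightarrow> partial_recursive k F \<and> decidable k (dom F)"


subsection \<open>Numberings and computable simulations\<close>

text \<open>
  A numbering is a function on \<open>Astar\<close>; the value of \<open>\<alpha>\<close> at the empty string is irrelevant
  throughout.
\<close>

definition numbering :: "(symb list \<Rightarrow> nat) \<Rightarrow> bool" where
  "numbering \<alpha> \<longleftrightarrow> inj_on \<alpha> Astar"

definition conc :: "(symb list \<Rightarrow> nat) \<Rightarrow> nat list \<Rightarrow> nat option" where
  "conc \<alpha> xs = (case xs of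
       [m, n] \<Rightarrow>
         if m \<in> \<alpha> ` Astar \<and> n \<in> \<alpha> ` Astar
         then Some (\<alpha> (inv_into Astar \<alpha> m @ inv_into Astar \<alpha> n))
         else None
     | _ \<Rightarrow> None)"

definition computable_simulation :: "(symb list \<Rightarrow> nat) \<Rightarrow> bool" where
  "computable_simulation \<alpha> \<longleftrightarrow>
     numbering \<alpha> \<and> decidable 1 {[m] | m. m \<in> \<alpha> ` Astar} \<and> recursive 2 (conc \<alpha>)"


subsection \<open>Well-definedness\<close>

lemma computes_unique: "computes c xs y \<Longrightarrow> computes c xs z \<Longrightarrow> y = z"
proof (induction arbitrary: z rule: computes.induct)
  case (comp xs gs ys f w)
  from comp.prems obtain ys' where ys': "list_all2 (\<lambda>g y. computes g xs y) gs ys'"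
    and w: "computes f ys' z"
    by cases auto
  have "ys = ys'"
    using comp.IH(1) ys' by (auto simp: list_all2_conv_all_nth intro!: nth_equalityI)
  with comp.IH(2) w show ?case by blast
next
  case (mu f n xs)
  from mu.prems have "computes f (z # xs) 0 \<and> (\<forall>m<z. \<exists>y. computes f (m # xs) (Suc y))"
    by cases auto
  then have z: "computes f (z # xs) 0"
    "\<And>m. m < z \<Longrightarrow> \<exists>y. computes f (m # xs) (Suc y)"
    by auto
  show ?case
  proof (rule linorder_cases[of n z])
    assume "n < z"
    from z(2)[OF this] obtain y where "computes f (n # xs) (Suc y)" by blast
    from mu.IH(1)[OF this] show ?thesis by simp
  next
    assume "z < n"
    from mu.IH(2)[OF this] z(1) show ?thesis by blast
  qed
next
  case (zero xs)
  from zero.prems show ?case by cases auto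
next
  case (succ x)
  from succ.prems show ?case by cases auto
next
  case (proj i xs)
  from proj.prems show ?case by cases auto
next
  case (primrec_0 f xs y g)
  from primrec_0.prems show ?case by cases (use primrec_0.IH in auto)
next
  case (primrec_Suc f g n xs y w)
  from primrec_Suc.prems obtain y' where "computes (PrimRec f g) (n # xs) y'"
    and "computes g (n # y' # xs) z"
    by cases auto
  with primrec_Suc.IH show ?case by blast
qed

lemma replicate_stroke_cancel:
  "replicate i SStroke @ r = replicate j SStroke @ r' \<Longrightarrow>
   (\<And>u. r \<noteq> SStroke # u) \<Longrightarrow> (\<And>u. r' \<noteq> SStroke # u) \<Longrightarrow> i = j \<and> r = r'"
proof (induction i arbitrary: j)
  case 0 then show ?case by (cases j) auto
next
  case (Suc i) then show ?case by (cases j) auto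
qed

lemma tm_str_cancel:
  "tm_str t @ r = tm_str t' @ r' \<Longrightarrow>
   (\<And>u. r \<noteq> SStroke # u) \<Longrightarrow> (\<And>u. r' \<noteq> SStroke # u) \<Longrightarrow> t = t' \<and> r = r'"
proof (induction t arbitrary: t' r r')
  case Zero
  from Zero.prems(1) show ?case by (cases t') (auto simp: var_str_def)
next
  case (Var i)
  show ?case
  proof (cases t')
    case (Var j)
    with Var.prems show ?thesis
      using replicate_stroke_cancel[of i r j r'] by (simp add: var_str_def)
  qed (use Var.prems(1) in \<open>auto simp: var_str_def\<close>)
next
  case (Succ t)
  show ?case
  proof (cases t')
    case eq: (Succ t1)
    with Succ.prems Succ.IH[of r t1 r'] show ?thesis by simp
  qed (use Succ.prems(1) in \<open>auto simp: var_str_def\<close>)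
next
  case (Add s t)
  show ?case
  proof (cases t')
    case eq: (Add s1 t1)
    with Add.prems have *: "tm_str s @ SPlus # tm_str t @ SRpar # r
        = tm_str s1 @ SPlus # tm_str t1 @ SRpar # r'" by simp
    from Add.IH(1)[OF *] have "s = s1" "tm_str t @ SRpar # r = tm_str t1 @ SRpar # r'"
      by auto
    with Add.IH(2)[of "SRpar # r" t1 "SRpar # r'"] eq show ?thesis by simp
  next
    case (Mult s1 t1)
    with Add.prems have "tm_str s @ SPlus # tm_str t @ SRpar # r
        = tm_str s1 @ STimes # tm_str t1 @ SRpar # r'" by simp
    from Add.IH(1)[OF this] show ?thesis by simp
  qed (use Add.prems(1) in \<open>auto simp: var_str_def\<close>)
next
  case (Mult s t)
  show ?case
  proof (cases t')
    case eq: (Mult s1 t1)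
    with Mult.prems have *: "tm_str s @ STimes # tm_str t @ SRpar # r
        = tm_str s1 @ STimes # tm_str t1 @ SRpar # r'" by simp
    from Mult.IH(1)[OF *] have "s = s1" "tm_str t @ SRpar # r = tm_str t1 @ SRpar # r'"
      by auto
    with Mult.IH(2)[of "SRpar # r" t1 "SRpar # r'"] eq show ?thesis by simp
  next
    case (Add s1 t1)
    with Mult.prems have "tm_str s @ STimes # tm_str t @ SRpar # r
        = tm_str s1 @ SPlus # tm_str t1 @ SRpar # r'" by simp
    from Mult.IH(1)[OF this] show ?thesis by simp
  qed (use Mult.prems(1) in \<open>auto simp: var_str_def\<close>)
qed

lemma tm_str_inj: "inj tm_str"
  by (rule injI) (use tm_str_cancel[of _ "[]" _ "[]"] in auto)

lemma fm_str_not_stroke: "fm_str p @ r \<noteq> SStroke # u"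
  by (cases p) auto

lemma tm_str_neq_fm_str: "tm_str t @ r \<noteq> fm_str p @ r'"
proof (induction p arbitrary: t r r')
  case (Eq s s')
  show ?case
  proof (cases t)
    case (Add a b)
    then show ?thesis
      using tm_str_cancel[of a "SPlus # tm_str b @ SRpar # r" s
          "SEq # tm_str s' @ SRpar # r'"] by auto
  next
    case (Mult a b)
    then show ?thesis
      using tm_str_cancel[of a "STimes # tm_str b @ SRpar # r" s
          "SEq # tm_str s' @ SRpar # r'"] by auto
  qed (auto simp: var_str_def)
next
  case (Neg p) then show ?case by (cases t) (auto simp: var_str_def)
next
  case (Conj p q) then show ?case by (cases t) (auto simp: var_str_def)
next
  case (Forall i p) then show ?case by (cases t) (auto simp: var_str_def)
qed

lemma fm_str_cancel: "fm_str p @ r = fm_str p' @ r' \<Longrightarrow> p = p' \<and> r = r'"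
proof (induction p arbitrary: p' r r')
  case (Eq s t)
  show ?case
  proof (cases p')
    case (Eq s' t')
    then show ?thesis
      using Eq.prems tm_str_cancel[of s "SEq # tm_str t @ SRpar # r" s'
          "SEq # tm_str t' @ SRpar # r'"]
        tm_str_cancel[of t "SRpar # r" t' "SRpar # r'"] by auto
  next
    case (Conj p q)
    then show ?thesis using Eq.prems by (simp add: tm_str_neq_fm_str)
  qed (use Eq.prems in auto)
next
  case (Neg p) then show ?case by (cases p') auto
next
  case (Conj p q)
  show ?case
  proof (cases p')
    case (Eq s' t')
    then show ?thesis using Conj.prems by (simp add: tm_str_neq_fm_str[symmetric])
  next
    case eq: (Conj p1 q1)
    with Conj.prems have *: "fm_str p @ SAnd # fm_str q @ SRpar # r
        = fm_str p1 @ SAnd # fm_str q1 @ SRpar # r'" by simp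
    from Conj.IH(1)[OF *] have "p = p1" "fm_str q @ SRpar # r = fm_str q1 @ SRpar # r'"
      by auto
    with Conj.IH(2)[of "SRpar # r" q1 "SRpar # r'"] eq show ?thesis by simp
  qed (use Conj.prems in auto)
next
  case (Forall i p)
  show ?case
  proof (cases p')
    case eq: (Forall j p1)
    with Forall.prems have "i = j \<and> fm_str p @ r = fm_str p1 @ r'"
      by (intro replicate_stroke_cancel) (auto simp: var_str_def fm_str_not_stroke)
    with eq Forall.IH[of r p1 r'] show ?thesis by simp
  qed (use Forall.prems in auto)
qed

lemma fm_str_inj: "inj fm_str"
  by (rule injI) (use fm_str_cancel[of _ "[]" _ "[]"] in auto)

end

theory Submission
  imports Defs "HOL-Number_Theory.Cong"
begin

text \<open>
  Every partial recursive graph is arithmetical (primitive recursion is unwound with Goedel's beta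
  function), in particular that of \<open>\<circledast>\<close> and of \<open>n \<mapsto> \<alpha>(S\<dots>S0)\<close>. Given a formula \<open>\<delta>\<close> in the single free
  variable \<open>v\<close>, with code \<open>n\<close>, the sentence \<open>\<forall>v \<not>((v=S\<dots>S0) \<and> \<not>\<delta>)\<close> says that \<open>n\<close> satisfies \<open>\<delta>\<close>, and
  its string contains that of \<open>\<delta>\<close> verbatim. Its code is thus obtained from \<open>n\<close> by finitely many
  applications of \<open>\<circledast>\<close>, so no syntactic substitution needs to be simulated on codes. If truth were
  arithmetical, some \<open>\<delta>\<close> would express that the sentence obtained in this way from \<open>n\<close> is false;
  the sentence obtained from \<open>\<delta>\<close> itself is then a liar.
\<close>

section \<open>Definable predicates on environments\<close>

text \<open>The formula stays behind an existential quantifier and its free variables are not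
  tracked, so definability can be proved by closure rules alone.
  \<open>definable_unary_formula\<close> later regains control of the free variables.\<close>

definition definable :: "((nat \<Rightarrow> nat) \<Rightarrow> bool) \<Rightarrow> bool" where
  "definable P \<longleftrightarrow> (\<exists>p. \<forall>e. sat e p \<longleftrightarrow> P e)"

definition is_term :: "((nat \<Rightarrow> nat) \<Rightarrow> nat) \<Rightarrow> bool" where
  "is_term f \<longleftrightarrow> (\<exists>t. \<forall>e. tm_val e t = f e)"

section \<open>Coincidence and simultaneous substitution\<close>

lemma tm_val_cong: "(\<And>i. i \<in> tm_vars t \<Longrightarrow> e i = e' i) \<Longrightarrow> tm_val e t = tm_val e' t"
  by (induction t) auto

lemma sat_cong: "(\<And>i. i \<in> free_vars p \<Longrightarrow> e i = e' i) \<Longrightarrow> sat e p \<longleftrightarrow> sat e' p"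
proof (induction p arbitrary: e e')
  case (Eq s t)
  then have "tm_val e s = tm_val e' s" "tm_val e t = tm_val e' t"
    by (auto intro: tm_val_cong)
  then show ?case by simp
next
  case (Neg p)
  then have "sat e p \<longleftrightarrow> sat e' p" by (metis free_vars.simps(2))
  then show ?case by simp
next
  case (Conj p q)
  then have "sat e p \<longleftrightarrow> sat e' p" "sat e q \<longleftrightarrow> sat e' q"
    by (metis UnCI free_vars.simps(3))+
  then show ?case by simp
next
  case (Forall i p)
  have "sat (e(i := n)) p \<longleftrightarrow> sat (e'(i := n)) p" for n
    by (rule Forall.IH) (use Forall.prems in auto)
  then show ?case by simp
qed

lemma finite_tm_vars: "finite (tm_vars t)"
  by (induction t) auto

lemma finite_free_vars: "finite (free_vars p)"
  by (induction p) (auto simp: finite_tm_vars)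

lemma substitute_tm:
  "\<exists>t'. (\<forall>e. tm_val e t' = tm_val (\<lambda>i. tm_val e (\<sigma> i)) t) \<and>
     tm_vars t' \<subseteq> (\<Union>i\<in>tm_vars t. tm_vars (\<sigma> i))"
proof (induction t)
  case Zero
  show ?case by (rule exI[of _ Zero]) simp
next
  case (Var i)
  show ?case by (rule exI[of _ "\<sigma> i"]) simp
next
  case (Succ t)
  then obtain t' where "\<forall>e. tm_val e t' = tm_val (\<lambda>i. tm_val e (\<sigma> i)) t"
    "tm_vars t' \<subseteq> (\<Union>i\<in>tm_vars t. tm_vars (\<sigma> i))" by blast
  then show ?case by (intro exI[of _ "Succ t'"]) simp
next
  case (Add s t)
  then obtain s' t' where "\<forall>e. tm_val e s' = tm_val (\<lambda>i. tm_val e (\<sigma> i)) s"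
    "tm_vars s' \<subseteq> (\<Union>i\<in>tm_vars s. tm_vars (\<sigma> i))"
    "\<forall>e. tm_val e t' = tm_val (\<lambda>i. tm_val e (\<sigma> i)) t"
    "tm_vars t' \<subseteq> (\<Union>i\<in>tm_vars t. tm_vars (\<sigma> i))" by blast
  then show ?case by (intro exI[of _ "Add s' t'"]) auto
next
  case (Mult s t)
  then obtain s' t' where "\<forall>e. tm_val e s' = tm_val (\<lambda>i. tm_val e (\<sigma> i)) s"
    "tm_vars s' \<subseteq> (\<Union>i\<in>tm_vars s. tm_vars (\<sigma> i))"
    "\<forall>e. tm_val e t' = tm_val (\<lambda>i. tm_val e (\<sigma> i)) t"
    "tm_vars t' \<subseteq> (\<Union>i\<in>tm_vars t. tm_vars (\<sigma> i))" by blast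
  then show ?case by (intro exI[of _ "Mult s' t'"]) auto
qed

lemma substitute_fm:
  "\<exists>q. (\<forall>e. sat e q \<longleftrightarrow> sat (\<lambda>i. tm_val e (\<sigma> i)) p) \<and>
     free_vars q \<subseteq> (\<Union>i\<in>free_vars p. tm_vars (\<sigma> i))"
proof (induction p arbitrary: \<sigma>)
  case (Eq s t)
  from substitute_tm[of \<sigma> s] substitute_tm[of \<sigma> t]
  obtain s' t' where "\<forall>e. tm_val e s' = tm_val (\<lambda>i. tm_val e (\<sigma> i)) s"
    "tm_vars s' \<subseteq> (\<Union>i\<in>tm_vars s. tm_vars (\<sigma> i))"
    "\<forall>e. tm_val e t' = tm_val (\<lambda>i. tm_val e (\<sigma> i)) t"
    "tm_vars t' \<subseteq> (\<Union>i\<in>tm_vars t. tm_vars (\<sigma> i))" by blast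
  then show ?case by (intro exI[of _ "Eq s' t'"]) auto
next
  case (Neg p)
  then obtain q where "\<forall>e. sat e q \<longleftrightarrow> sat (\<lambda>i. tm_val e (\<sigma> i)) p"
    "free_vars q \<subseteq> (\<Union>i\<in>free_vars p. tm_vars (\<sigma> i))" by blast
  then show ?case by (intro exI[of _ "Neg q"]) auto
next
  case (Conj p p')
  from Conj.IH(1)[of \<sigma>] Conj.IH(2)[of \<sigma>]
  obtain q q' where "\<forall>e. sat e q \<longleftrightarrow> sat (\<lambda>i. tm_val e (\<sigma> i)) p"
    "free_vars q \<subseteq> (\<Union>i\<in>free_vars p. tm_vars (\<sigma> i))"
    "\<forall>e. sat e q' \<longleftrightarrow> sat (\<lambda>i. tm_val e (\<sigma> i)) p'"
    "free_vars q' \<subseteq> (\<Union>i\<in>free_vars p'. tm_vars (\<sigma> i))" by blast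
  then show ?case by (intro exI[of _ "Conj q q'"]) auto
next
  case (Forall i p)
  define V where "V = (\<Union>j\<in>free_vars p. tm_vars (\<sigma> j))"
  have "finite V" by (simp add: V_def finite_free_vars finite_tm_vars)
  \<comment> \<open>No term substituted for a free variable of \<open>p\<close> mentions
    \<open>z\<close>, so renaming the bound variable \<open>i\<close> to \<open>z\<close> prevents
    capture.\<close>
  then obtain z where z: "z \<notin> V" using ex_new_if_finite infinite_UNIV_nat by blast
  from Forall.IH[of "\<sigma>(i := Var z)"] obtain q where
    q: "\<And>e. sat e q \<longleftrightarrow> sat (\<lambda>j. tm_val e ((\<sigma>(i := Var z)) j)) p"
    and fv: "free_vars q \<subseteq> (\<Union>j\<in>free_vars p. tm_vars ((\<sigma>(i := Var z)) j))" by blast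
  have "sat (e(z := n)) q \<longleftrightarrow> sat ((\<lambda>j. tm_val e (\<sigma> j))(i := n)) p" for e n
    unfolding q
  proof (rule sat_cong)
    fix j assume "j \<in> free_vars p"
    with z have "z \<notin> tm_vars (\<sigma> j)" by (auto simp: V_def)
    then have "tm_val (e(z := n)) (\<sigma> j) = tm_val e (\<sigma> j)"
      by (intro tm_val_cong) auto
    then show "tm_val (e(z := n)) ((\<sigma>(i := Var z)) j) = ((\<lambda>j. tm_val e (\<sigma> j))(i := n)) j"
      by simp
  qed
  moreover have "free_vars (Forall z q) \<subseteq> (\<Union>j\<in>free_vars (Forall i p). tm_vars (\<sigma> j))"
    using fv by (auto split: if_splits)
  ultimately show ?case by (intro exI[of _ "Forall z q"]) simp
qed

lemma definable_substitute:
  assumes "definable P" and "\<And>i. is_term (f i)"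
  shows "definable (\<lambda>e. P (\<lambda>i. f i e))"
proof -
  from assms(1) obtain p where p: "\<And>e. sat e p \<longleftrightarrow> P e" unfolding definable_def by blast
  from assms(2) obtain \<sigma> where \<sigma>: "\<And>i e. tm_val e (\<sigma> i) = f i e"
    unfolding is_term_def by metis
  from substitute_fm[of \<sigma> p] show ?thesis unfolding definable_def by (auto simp: p \<sigma>)
qed

section \<open>Closure rules for terms and definable predicates\<close>

lemma is_term_var: "is_term (\<lambda>e. e i)"
  unfolding is_term_def by (rule exI[of _ "Var i"]) simp

lemma is_term_Suc: "is_term f \<Longrightarrow> is_term (\<lambda>e. Suc (f e))"
  unfolding is_term_def by (metis tm_val.simps(3))

lemma is_term_const: "is_term (\<lambda>e. n)"
proof (induction n)
  case 0
  show ?case unfolding is_term_def by (rule exI[of _ Zero]) simp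
qed (rule is_term_Suc)

lemma is_term_add: "is_term f \<Longrightarrow> is_term g \<Longrightarrow> is_term (\<lambda>e. f e + g e)"
  unfolding is_term_def by (metis tm_val.simps(4))

lemma is_term_mult: "is_term f \<Longrightarrow> is_term g \<Longrightarrow> is_term (\<lambda>e. f e * g e)"
  unfolding is_term_def by (metis tm_val.simps(5))

text \<open>Used when passing under a quantifier: entry 0 becomes the bound variable, and a term
  from outside must then read the environment one place further on.\<close>

lemma is_term_shift: "is_term f \<Longrightarrow> is_term (\<lambda>e. f (\<lambda>i. e (Suc i)))"
proof -
  assume "is_term f"
  then obtain t where t: "\<And>e. tm_val e t = f e" unfolding is_term_def by blast
  from substitute_tm[of "\<lambda>i. Var (Suc i)" t] show ?thesis
    unfolding is_term_def by (auto simp: t)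
qed

lemma definable_eq: "is_term f \<Longrightarrow> is_term g \<Longrightarrow> definable (\<lambda>e. f e = g e)"
  unfolding is_term_def definable_def by (metis sat.simps(1))

lemma definable_not: "definable P \<Longrightarrow> definable (\<lambda>e. \<not> P e)"
  unfolding definable_def by (metis sat.simps(2))

lemma definable_conj: "definable P \<Longrightarrow> definable Q \<Longrightarrow> definable (\<lambda>e. P e \<and> Q e)"
  unfolding definable_def by (metis sat.simps(3))

lemma definable_imp: "definable P \<Longrightarrow> definable Q \<Longrightarrow> definable (\<lambda>e. P e \<longrightarrow> Q e)"
  using definable_not[OF definable_conj[OF _ definable_not, of P Q]] by simp

lemma definable_False: "definable (\<lambda>e. False)"
  using definable_eq[OF is_term_const[of 0] is_term_const[of 1]] by simp

text \<open>Quantifiers are handled in de Bruijn style: the bound variable becomes entry 0 of the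
  environment.\<close>

lemma definable_all:
  assumes "definable (\<lambda>e. P (e 0) (\<lambda>i. e (Suc i)))"
  shows "definable (\<lambda>e. \<forall>n. P n e)"
proof -
  from assms obtain p where p: "\<And>e. sat e p \<longleftrightarrow> P (e 0) (\<lambda>i. e (Suc i))"
    unfolding definable_def by blast
  \<comment> \<open>The formula \<open>q\<close> below reads entry 0 of \<open>p\<close> from
    variable \<open>z\<close> and entry \<open>Suc j\<close> from variable \<open>j\<close>. With
    \<open>Suc z\<close> not free in \<open>p\<close>, the outer variable \<open>z\<close> does not
    clash with the bound one.\<close>
  obtain z where z: "z \<notin> free_vars p" "Suc z \<notin> free_vars p"
  proof -
    have "finite (free_vars p \<union> Suc -` free_vars p)"
      by (simp add: finite_free_vars finite_vimageI)
    then obtain z where "z \<notin> free_vars p \<union> Suc -` free_vars p"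
      using ex_new_if_finite infinite_UNIV_nat by blast
    then show ?thesis using that by blast
  qed
  from substitute_fm[of "\<lambda>i. Var (case i of 0 \<Rightarrow> z | Suc j \<Rightarrow> j)" p] obtain q where
    q: "\<And>e. sat e q \<longleftrightarrow> sat (\<lambda>i. e (case i of 0 \<Rightarrow> z | Suc j \<Rightarrow> j)) p" by auto
  have "sat (e(z := n)) q \<longleftrightarrow> P n e" for e n
  proof -
    have "sat (e(z := n)) q \<longleftrightarrow> sat (\<lambda>i. case i of 0 \<Rightarrow> n | Suc j \<Rightarrow> e j) p"
      unfolding q by (rule sat_cong) (use z in \<open>auto split: nat.splits\<close>)
    then show ?thesis by (simp add: p)
  qed
  then have "\<forall>e. sat e (Forall z q) \<longleftrightarrow> (\<forall>n. P n e)" by simp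
  then show ?thesis unfolding definable_def by blast
qed

lemma definable_ex:
  assumes "definable (\<lambda>e. P (e 0) (\<lambda>i. e (Suc i)))"
  shows "definable (\<lambda>e. \<exists>n. P n e)"
  using definable_not[OF definable_all[OF definable_not[OF assms]]] by simp

lemma definable_less:
  assumes "is_term f" "is_term g" shows "definable (\<lambda>e. f e < g e)"
proof -
  have "definable (\<lambda>e. \<exists>d. Suc (f e + d) = g e)"
    by (intro definable_ex definable_eq is_term_Suc is_term_add is_term_var is_term_shift assms)
  then show ?thesis by (simp add: less_iff_Suc_add eq_commute)
qed

lemmas is_term_intros =
  is_term_var is_term_const is_term_Suc is_term_add is_term_mult is_term_shift

lemmas definable_intros =
  definable_eq definable_less definable_not definable_conj definable_imp definable_ex
  definable_all

section \<open>Goedel's beta function\<close>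

definition beta :: "nat \<Rightarrow> nat \<Rightarrow> nat \<Rightarrow> nat" where
  "beta a b i = a mod Suc (Suc i * b)"

text \<open>Since \<open>mod\<close> is no symbol of the language, \<open>beta\<close> enters
  through its graph: a remainder is characterised by being below the modulus and differing from the
  dividend by a multiple of it.\<close>

lemma definable_beta:
  assumes "is_term f" "is_term g" "is_term h" "is_term k"
  shows "definable (\<lambda>e. beta (f e) (g e) (h e) = k e)"
proof -
  have "beta a b i = v \<longleftrightarrow> v < Suc (Suc i * b) \<and> (\<exists>q. a = q * Suc (Suc i * b) + v)" for a b i v
    unfolding beta_def
    by (metis mod_less_divisor zero_less_Suc div_mult_mod_eq mod_mult_self3 mod_less)
  moreover have "definable (\<lambda>e. k e < Suc (Suc (h e) * g e) \<and>
      (\<exists>q. f e = q * Suc (Suc (h e) * g e) + k e))"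
    by (intro definable_intros is_term_intros assms)
  ultimately show ?thesis by simp
qed

text \<open>A common divisor divides the difference \<open>(j - i) * b\<close>, hence
  \<open>b * b\<close>, because \<open>j - i\<close> is at most \<open>n\<close> and so divides
  \<open>b\<close>. But each modulus is 1 modulo \<open>b\<close>, so the divisor is also coprime to
  \<open>b\<close>.\<close>

lemma coprime_beta_moduli:
  fixes b :: nat
  assumes "i < j" "j \<le> n" "fact n dvd b"
  shows "coprime (Suc (Suc i * b)) (Suc (Suc j * b))"
proof (rule coprimeI)
  fix c assume c: "c dvd Suc (Suc i * b)" "c dvd Suc (Suc j * b)"
  have "c dvd (j - i) * b"
  proof -
    have "Suc (Suc j * b) - Suc (Suc i * b) = (j - i) * b"
      using assms(1) by (simp add: diff_mult_distrib)
    with c show ?thesis by (metis dvd_diff_nat)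
  qed
  moreover have "j - i dvd b"
    using dvd_fact[of "j - i" n] dvd_trans[of "j - i" "fact n" b] assms by simp
  ultimately have "c dvd b * b" by (meson dvd_trans mult_dvd_mono dvd_refl)
  moreover have "coprime c b"
  proof (rule coprimeI)
    fix d assume "d dvd c" "d dvd b"
    then have "d dvd Suc (Suc i * b)" "d dvd Suc i * b" using c by auto
    then show "is_unit d" by (metis dvd_add_right_iff Suc_eq_plus1 One_nat_def)
  qed
  ultimately show "is_unit c"
    by (metis coprime_dvd_mult_right_iff coprime_common_divisor dvd_refl)
qed

lemma beta_exists: "\<exists>a b. \<forall>i\<le>n. beta a b i = s i"
proof -
  \<comment> \<open>The factorial makes the moduli pairwise coprime; the other factor puts every
    modulus above all the \<open>s i\<close>, so that congruence to \<open>s i\<close> forces the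
    remainder to equal it.\<close>
  define b :: nat where "b = fact n * Suc (Max (s ` {..n}))"
  have cop: "\<forall>i\<in>{..n}. \<forall>j\<in>{..n}. i \<noteq> j \<longrightarrow> coprime (Suc (Suc i * b)) (Suc (Suc j * b))"
  proof (intro ballI impI)
    fix i j assume "i \<in> {..n}" "j \<in> {..n}" "i \<noteq> j"
    moreover have "fact n dvd b" by (simp add: b_def)
    ultimately show "coprime (Suc (Suc i * b)) (Suc (Suc j * b))"
      by (metis coprime_beta_moduli coprime_commute linorder_neqE_nat atMost_iff)
  qed
  obtain a where a: "\<forall>i\<in>{..n}. [a = s i] (mod Suc (Suc i * b))"
    using chinese_remainder_nat[OF _ cop, of s] by auto
  have "beta a b i = s i" if "i \<le> n" for i
  proof -
    have "s i \<le> Max (s ` {..n})" using that by simp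
    also have "\<dots> < Suc (Max (s ` {..n}))" by simp
    also have "\<dots> \<le> b" by (simp add: b_def del: mult_Suc_right)
    also have "\<dots> < Suc (Suc i * b)" by simp
    finally show ?thesis using a that by (simp add: beta_def cong_def)
  qed
  then show ?thesis by blast
qed

section \<open>Partial recursive graphs are definable\<close>

inductive_cases computes_ZeroE: "computes ZeroF xs y"
inductive_cases computes_SuccE: "computes SuccF xs y"
inductive_cases computes_ProjE: "computes (Proj i) xs y"
inductive_cases computes_CompE: "computes (Comp f gs) xs y"
inductive_cases computes_PrimRecE: "computes (PrimRec f g) xs y"
inductive_cases computes_MuE: "computes (Mu f) xs y"

lemma computes_Zero_iff: "computes ZeroF xs y \<longleftrightarrow> y = 0"
  by (auto elim: computes_ZeroE intro: computes.intros)

lemma computes_Succ_iff: "computes SuccF xs y \<longleftrightarrow> (\<exists>x. xs = [x] \<and> y = Suc x)"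
  by (auto elim: computes_SuccE intro: computes.intros)

lemma computes_Proj_iff: "computes (Proj i) xs y \<longleftrightarrow> i < length xs \<and> y = xs ! i"
  by (auto elim: computes_ProjE intro: computes.intros)

lemma computes_Comp_iff: "computes (Comp f gs) xs z \<longleftrightarrow>
    (\<exists>ys. list_all2 (\<lambda>g y. computes g xs y) gs ys \<and> computes f ys z)"
  by (auto elim: computes_CompE intro: computes.comp)

lemma computes_Mu_iff: "computes (Mu f) xs n \<longleftrightarrow>
    computes f (n # xs) 0 \<and> (\<forall>m. m < n \<longrightarrow> (\<exists>y. computes f (m # xs) (Suc y)))"
  by (auto elim: computes_MuE intro: computes.mu)

lemma computes_PrimRec_Nil_iff: "\<not> computes (PrimRec f g) [] z"
  by (auto elim: computes_PrimRecE)

lemma computes_PrimRec_0_iff: "computes (PrimRec f g) (0 # xs) z \<longleftrightarrow> computes f xs z"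
  by (auto elim: computes_PrimRecE intro: computes.primrec_0)

lemma computes_PrimRec_Suc_iff: "computes (PrimRec f g) (Suc n # xs) z \<longleftrightarrow>
    (\<exists>y. computes (PrimRec f g) (n # xs) y \<and> computes g (n # y # xs) z)"
  by (auto elim: computes_PrimRecE intro: computes.primrec_Suc)

text \<open>The recursion is unwound into the sequence of its intermediate values, the object that
  \<open>beta\<close> can code by two numbers.\<close>

lemma computes_PrimRec_iff_sequence:
  "computes (PrimRec f g) (n # xs) z \<longleftrightarrow>
    (\<exists>s. computes f xs (s 0) \<and> (\<forall>i<n. computes g (i # s i # xs) (s (Suc i))) \<and> s n = z)"
proof (induction n arbitrary: z)
  case 0
  show ?case unfolding computes_PrimRec_0_iff by (auto intro: exI[of _ "\<lambda>_. z"])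
next
  case (Suc n)
  show ?case unfolding computes_PrimRec_Suc_iff Suc
  proof (intro iffI; elim exE conjE)
    fix y s
    assume "computes g (n # y # xs) z" "computes f xs (s 0)"
      "\<forall>i<n. computes g (i # s i # xs) (s (Suc i))" "s n = y"
    then show "\<exists>s. computes f xs (s 0) \<and>
        (\<forall>i<Suc n. computes g (i # s i # xs) (s (Suc i))) \<and> s (Suc n) = z"
      by (intro exI[of _ "s(Suc n := z)"]) (auto simp: less_Suc_eq)
  next
    fix s
    assume "computes f xs (s 0)" "\<forall>i<Suc n. computes g (i # s i # xs) (s (Suc i))" "s (Suc n) = z"
    then show "\<exists>y. (\<exists>s. computes f xs (s 0) \<and> (\<forall>i<n. computes g (i # s i # xs) (s (Suc i))) \<and>
        s n = y) \<and> computes g (n # y # xs) z"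
      by (intro exI[of _ "s n"] conjI exI[of _ s]) auto
  qed
qed

text \<open>One direction codes the sequence up to \<open>n\<close> by \<open>beta_exists\<close>,
  the other takes \<open>beta a b\<close> itself as the sequence. The values of \<open>beta\<close>
  are named by \<open>y\<close>, \<open>u\<close> and \<open>v\<close> so that \<open>f\<close> and
  \<open>g\<close> are applied only to terms.\<close>

lemma computes_PrimRec_iff_beta:
  "computes (PrimRec f g) (n # xs) z \<longleftrightarrow>
    (\<exists>a b. (\<exists>y. beta a b 0 = y \<and> computes f xs y) \<and>
      (\<forall>i. i < n \<longrightarrow> (\<exists>u v. beta a b i = u \<and> beta a b (Suc i) = v \<and>
        computes g (i # u # xs) v)) \<and> beta a b n = z)"
proof -
  have "(\<exists>s. computes f xs (s 0) \<and> (\<forall>i<n. computes g (i # s i # xs) (s (Suc i))) \<and> s n = z)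
    \<longleftrightarrow> (\<exists>a b. computes f xs (beta a b 0) \<and>
      (\<forall>i<n. computes g (i # beta a b i # xs) (beta a b (Suc i))) \<and> beta a b n = z)"
  proof (intro iffI; elim exE conjE)
    fix s assume s: "computes f xs (s 0)" "\<forall>i<n. computes g (i # s i # xs) (s (Suc i))" "s n = z"
    obtain a b where "\<forall>i\<le>n. beta a b i = s i" using beta_exists by blast
    with s show "\<exists>a b. computes f xs (beta a b 0) \<and>
      (\<forall>i<n. computes g (i # beta a b i # xs) (beta a b (Suc i))) \<and> beta a b n = z"
      by (intro exI[of _ a] exI[of _ b]) simp
  next
    fix a b assume "computes f xs (beta a b 0)"
      "\<forall>i<n. computes g (i # beta a b i # xs) (beta a b (Suc i))" "beta a b n = z"
    then show "\<exists>s. computes f xs (s 0) \<and>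
      (\<forall>i<n. computes g (i # s i # xs) (s (Suc i))) \<and> s n = z"
      by (intro exI[of _ "beta a b"]) simp
  qed
  then show ?thesis unfolding computes_PrimRec_iff_sequence by simp
qed

text \<open>Arbitrary terms are allowed as arguments and as value, so that an induction hypothesis
  on a program can be applied under any number of quantifiers.\<close>

definition definable_graph :: "recf \<Rightarrow> bool" where
  "definable_graph c \<longleftrightarrow> (\<forall>fs g. (\<forall>f\<in>set fs. is_term f) \<longrightarrow> is_term g \<longrightarrow>
     definable (\<lambda>e. computes c (map (\<lambda>f. f e) fs) (g e)))"

lemma definable_graphD:
  assumes "definable_graph c" "\<And>f. f \<in> set fs \<Longrightarrow> is_term f" "is_term g"
  shows "definable (\<lambda>e. computes c (map (\<lambda>f. f e) fs) (g e))"
  using assms unfolding definable_graph_def by blast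

abbreviation shift :: "((nat \<Rightarrow> nat) \<Rightarrow> 'a) \<Rightarrow> (nat \<Rightarrow> nat) \<Rightarrow> 'a" where
  "shift f \<equiv> (\<lambda>e. f (\<lambda>i. e (Suc i)))"

text \<open>The quantifier over the list \<open>ys\<close> is traded for one number quantifier per
  program in \<open>gs\<close>. The list \<open>hs\<close> accumulates the values already chosen,
  which is why the claim is generalised from the empty \<open>hs\<close>.\<close>

lemma definable_graph_Comp:
  assumes "\<And>g. g \<in> set gs \<Longrightarrow> definable_graph g" "definable_graph f"
    "\<And>h. h \<in> set fs \<Longrightarrow> is_term h" "\<And>h. h \<in> set hs \<Longrightarrow> is_term h" "is_term k"
  shows "definable (\<lambda>e. \<exists>ys. list_all2 (\<lambda>g y. computes g (map (\<lambda>h. h e) fs) y) gs ys \<and>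
      computes f (map (\<lambda>h. h e) hs @ ys) (k e))"
  using assms
proof (induction gs arbitrary: fs hs k)
  case Nil
  then show ?case using definable_graphD[of f hs k] by simp
next
  case (Cons g gs)
  have *: "definable (\<lambda>e. computes g (map (\<lambda>h. h e) (map shift fs)) (e 0) \<and>
     (\<exists>ys. list_all2 (\<lambda>g y. computes g (map (\<lambda>h. h e) (map shift fs)) y) gs ys \<and>
      computes f (map (\<lambda>h. h e) (map shift hs @ [\<lambda>e. e 0]) @ ys) (shift k e)))"
    by (rule definable_conj[OF definable_graphD Cons.IH])
      (use Cons.prems in \<open>auto intro!: is_term_intros\<close>)
  have "definable (\<lambda>e. \<exists>y. computes g (map (\<lambda>h. h e) fs) y \<and>
     (\<exists>ys. list_all2 (\<lambda>g y. computes g (map (\<lambda>h. h e) fs) y) gs ys \<and>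
      computes f (map (\<lambda>h. h e) hs @ y # ys) (k e)))"
    by (rule definable_ex) (use * in \<open>simp add: comp_def\<close>)
  moreover have "(\<exists>y. computes g xs y \<and> (\<exists>ys. list_all2 (\<lambda>g y. computes g xs y) gs ys \<and>
      computes f (us @ y # ys) z)) \<longleftrightarrow>
     (\<exists>ys. list_all2 (\<lambda>g y. computes g xs y) (g # gs) ys \<and> computes f (us @ ys) z)" for xs us z
    by (auto simp: list_all2_Cons1)
  ultimately show ?case by simp
qed

lemma definable_graph: "definable_graph c"
proof (induction c)
  case ZeroF
  show ?case unfolding definable_graph_def computes_Zero_iff
    by (intro allI impI definable_intros is_term_intros)
next
  case SuccF
  show ?case unfolding definable_graph_def
  proof (intro allI impI)
    fix fs :: "((nat \<Rightarrow> nat) \<Rightarrow> nat) list" and g :: "(nat \<Rightarrow> nat) \<Rightarrow> nat"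
    assume fs: "\<forall>f\<in>set fs. is_term f" and g: "is_term g"
    show "definable (\<lambda>e. computes SuccF (map (\<lambda>f. f e) fs) (g e))"
    proof (cases "\<exists>h. fs = [h]")
      case True
      then obtain h where "fs = [h]" by blast
      with fs g show ?thesis
        by (auto simp: computes_Succ_iff intro!: definable_intros is_term_intros)
    next
      case False
      then have "\<not> computes SuccF (map (\<lambda>f. f e) fs) y" for e y
        by (auto simp: computes_Succ_iff)
      then show ?thesis by (simp add: definable_False)
    qed
  qed
next
  case (Proj i)
  show ?case unfolding definable_graph_def
  proof (intro allI impI)
    fix fs :: "((nat \<Rightarrow> nat) \<Rightarrow> nat) list" and g :: "(nat \<Rightarrow> nat) \<Rightarrow> nat"
    assume fs: "\<forall>f\<in>set fs. is_term f" and g: "is_term g"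
    show "definable (\<lambda>e. computes (Proj i) (map (\<lambda>f. f e) fs) (g e))"
      by (cases "i < length fs") (use fs g in
        \<open>auto simp: computes_Proj_iff definable_False intro!: definable_intros is_term_intros\<close>)
  qed
next
  case (Comp f gs)
  show ?case unfolding definable_graph_def computes_Comp_iff
    using definable_graph_Comp[OF Comp(2,1), where hs = "[]"] by simp
next
  case (PrimRec f g)
  show ?case unfolding definable_graph_def
  proof (intro allI impI)
    fix fs :: "((nat \<Rightarrow> nat) \<Rightarrow> nat) list" and k :: "(nat \<Rightarrow> nat) \<Rightarrow> nat"
    assume fs: "\<forall>f\<in>set fs. is_term f" and k: "is_term k"
    show "definable (\<lambda>e. computes (PrimRec f g) (map (\<lambda>f. f e) fs) (k e))"
    proof (cases fs)
      case Nil
      then show ?thesis by (simp add: computes_PrimRec_Nil_iff definable_False)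
    next
      case (Cons h hs)
      with fs have h: "is_term h" and hs: "\<forall>f\<in>set hs. is_term f" by auto
      \<comment> \<open>Inside the binders \<open>a\<close>, \<open>b\<close>, \<open>y\<close>:
        outer terms are shifted three times and entry 0 is \<open>y\<close>.\<close>
      have F: "definable (\<lambda>e. computes f (map (\<lambda>h. h (\<lambda>i. e (Suc (Suc (Suc i))))) hs) (e 0))"
      proof -
        have "definable (\<lambda>e. computes f (map (\<lambda>h. h e) (map (\<lambda>h. shift (shift (shift h))) hs)) (e 0))"
          by (rule definable_graphD[OF PrimRec(1)]) (use hs in \<open>auto intro!: is_term_intros\<close>)
        then show ?thesis by (simp add: comp_def)
      qed
      \<comment> \<open>Inside the binders \<open>a\<close>, \<open>b\<close>, \<open>i\<close>,
        \<open>u\<close>, \<open>v\<close>: outer terms are shifted five times, and entries 2, 1, 0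
        are \<open>i\<close>, \<open>u\<close>, \<open>v\<close>.\<close>
      have G: "definable (\<lambda>e. computes g
          (e 2 # e 1 # map (\<lambda>h. h (\<lambda>i. e (Suc (Suc (Suc (Suc (Suc i))))))) hs) (e 0))"
      proof -
        have "definable (\<lambda>e. computes g (map (\<lambda>h. h e) ((\<lambda>e. e 2) # (\<lambda>e. e 1) #
            map (\<lambda>h. shift (shift (shift (shift (shift h))))) hs)) (e 0))"
          by (rule definable_graphD[OF PrimRec(2)]) (use hs in \<open>auto intro!: is_term_intros\<close>)
        then show ?thesis by (simp add: comp_def)
      qed
      have "definable (\<lambda>e. \<exists>a b.
        (\<exists>y. beta a b 0 = y \<and> computes f (map (\<lambda>h. h e) hs) y) \<and>
        (\<forall>i. i < h e \<longrightarrow> (\<exists>u v. beta a b i = u \<and> beta a b (Suc i) = v \<and>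
          computes g (i # u # map (\<lambda>h. h e) hs) v)) \<and> beta a b (h e) = k e)"
        by (intro F G[unfolded numeral_2_eq_2 One_nat_def] definable_beta definable_intros
            h k is_term_intros)
      with Cons show ?thesis by (simp add: computes_PrimRec_iff_beta)
    qed
  qed
next
  case (Mu f)
  show ?case unfolding definable_graph_def
  proof (intro allI impI)
    fix fs :: "((nat \<Rightarrow> nat) \<Rightarrow> nat) list" and k :: "(nat \<Rightarrow> nat) \<Rightarrow> nat"
    assume fs: "\<forall>f\<in>set fs. is_term f" and k: "is_term k"
    have 1: "definable (\<lambda>e. computes f (k e # map (\<lambda>h. h e) fs) 0)"
      using definable_graphD[OF Mu, of "k # fs" "\<lambda>e. 0"] fs k
      by (auto intro!: is_term_intros)
    \<comment> \<open>Inside the binders \<open>m\<close> and \<open>y\<close>, which are entries 1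
      and 0.\<close>
    have 2: "definable (\<lambda>e. computes f (e 1 # map (\<lambda>h. h (\<lambda>i. e (Suc (Suc i)))) fs) (Suc (e 0)))"
    proof -
      have "definable (\<lambda>e. computes f (map (\<lambda>h. h e) ((\<lambda>e. e 1) #
          map (\<lambda>h. shift (shift h)) fs)) (Suc (e 0)))"
        by (rule definable_graphD[OF Mu]) (use fs in \<open>auto intro!: is_term_intros\<close>)
      then show ?thesis by (simp add: comp_def)
    qed
    show "definable (\<lambda>e. computes (Mu f) (map (\<lambda>f. f e) fs) (k e))"
      unfolding computes_Mu_iff
      by (intro 1 2[unfolded One_nat_def] definable_intros k is_term_intros)
  qed
qed

lemma definable_computes2:
  assumes "is_term f" "is_term g" "is_term h"
  shows "definable (\<lambda>e. computes c [f e, g e] (h e))"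
  using definable_graphD[OF definable_graph, of "[f, g]" h c] assms by auto

lemma definable_computes3:
  assumes "is_term f" "is_term g" "is_term h" "is_term k"
  shows "definable (\<lambda>e. computes c [f e, g e, h e] (k e))"
  using definable_graphD[OF definable_graph, of "[f, g, h]" k c] assms by auto

section \<open>The diagonal argument\<close>

lemma definable_arithmetical:
  assumes "arithmetical X" "is_term f"
  shows "definable (\<lambda>e. f e \<in> X)"
proof -
  from assms(1) obtain p i where p: "\<And>e n. n \<in> X \<longleftrightarrow> sat (e(i := n)) p"
    unfolding arithmetical_def by blast
  have "sat e p \<longleftrightarrow> e i \<in> X" for e using p[of "e i" e] by simp
  then have "definable (\<lambda>e. e i \<in> X)" unfolding definable_def by blast
  \<comment> \<open>Every variable is replaced by \<open>f\<close>, which is harmless because the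
    predicate reads only entry \<open>i\<close>.\<close>
  from definable_substitute[OF this, of "\<lambda>_. f"] assms(2) show ?thesis by simp
qed

text \<open>Replacing every variable by variable 0 leaves at most that one free. The meaning
  survives because the predicate depends on entry 0 only.\<close>

lemma definable_unary_formula:
  assumes "definable (\<lambda>e. P (e 0))"
  shows "\<exists>p. free_vars p \<subseteq> {0} \<and> (\<forall>e. sat e p \<longleftrightarrow> P (e 0))"
proof -
  from assms obtain p where p: "\<And>e. sat e p \<longleftrightarrow> P (e 0)" unfolding definable_def by blast
  from substitute_fm[of "\<lambda>_. Var 0" p] obtain q where
    "\<forall>e. sat e q \<longleftrightarrow> sat (\<lambda>_. e 0) p" "free_vars q \<subseteq> {0}" by fastforce
  then show ?thesis using p by auto
qed

section \<open>Numerals, instances and their strings\<close>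

definition numeral_tm :: "nat \<Rightarrow> tm" where
  "numeral_tm n = (Succ ^^ n) Zero"

lemma tm_val_numeral [simp]: "tm_val e (numeral_tm n) = n"
  unfolding numeral_tm_def by (induction n) auto

lemma tm_vars_numeral [simp]: "tm_vars (numeral_tm n) = {}"
  unfolding numeral_tm_def by (induction n) auto

lemma tm_str_numeral_0: "tm_str (numeral_tm 0) = [SZero]"
  by (simp add: numeral_tm_def)

lemma tm_str_numeral_Suc: "tm_str (numeral_tm (Suc n)) = SSuc # tm_str (numeral_tm n)"
  by (simp add: numeral_tm_def)

lemma tm_str_nonempty: "tm_str t \<noteq> []"
  by (cases t) (auto simp: var_str_def)

lemma fm_str_nonempty: "fm_str p \<noteq> []"
  by (cases p) auto

definition instance_fm :: "fm \<Rightarrow> nat \<Rightarrow> fm" where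
  "instance_fm p n = Forall 0 (Neg (Conj (Eq (Var 0) (numeral_tm n)) (Neg p)))"

lemma sentence_instance: "free_vars p \<subseteq> {0} \<Longrightarrow> sentence (instance_fm p n)"
  by (auto simp: sentence_def instance_fm_def)

lemma sat_instance: "sat e (instance_fm p n) \<longleftrightarrow> sat (e(0 := n)) p"
  by (auto simp: instance_fm_def)

abbreviation "prefix_str \<equiv> [SAll, SVar, SNot, SLpar, SLpar, SVar, SEq]"
abbreviation "middle_str \<equiv> [SRpar, SAnd, SNot]"

text \<open>The left-nested bracketing is the order in which the diagonal predicate \<open>D\<close>
  below concatenates codes.\<close>

lemma instance_str:
  "fm_str (instance_fm p n) =
    (((prefix_str @ tm_str (numeral_tm n)) @ middle_str) @ fm_str p) @ [SRpar]"
  by (simp add: instance_fm_def var_str_def)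

text \<open>Applied to \<open>[n, a, b]\<close>, where \<open>c\<close> computes \<open>\<circledast>\<close>, this computes \<open>b \<circledast> \<dots> \<circledast> b \<circledast> a\<close> with \<open>n\<close> copies of \<open>b\<close>.\<close>

definition iterate_conc :: "recf \<Rightarrow> recf" where
  "iterate_conc c = PrimRec (Proj 0) (Comp c [Proj 3, Proj 1])"

lemma computes_iterate_conc:
  assumes c: "\<And>u v y. u \<noteq> [] \<Longrightarrow> v \<noteq> [] \<Longrightarrow> computes c [\<alpha> u, \<alpha> v] y \<longleftrightarrow> y = \<alpha> (u @ v)"
  shows "computes (iterate_conc c) [n, \<alpha> [SZero], \<alpha> [SSuc]] y \<longleftrightarrow> y = \<alpha> (tm_str (numeral_tm n))"
proof (induction n arbitrary: y)
  case 0
  show ?case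
    by (simp add: iterate_conc_def computes_PrimRec_0_iff computes_Proj_iff tm_str_numeral_0)
next
  case (Suc n)
  \<comment> \<open>The step program receives
    \<open>[n, y, \<alpha> [SZero], \<alpha> [SSuc]]\<close>, so \<open>Proj 3\<close> and
    \<open>Proj 1\<close> prepend one successor symbol to the string coded by
    \<open>y\<close>.\<close>
  show ?case unfolding iterate_conc_def computes_PrimRec_Suc_iff
    unfolding iterate_conc_def[symmetric] Suc
    by (simp add: computes_Comp_iff computes_Proj_iff list_all2_Cons1 c tm_str_nonempty
        tm_str_numeral_Suc)
qed

theorem theorem4p5:
  fixes \<alpha> :: "symb list \<Rightarrow> nat"
  assumes "computable_simulation \<alpha>"
  shows "\<not> arithmetical {\<alpha> (fm_str \<phi>) | \<phi>. sentence \<phi> \<and> true_in_N \<phi>}"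
proof
  let ?T = "{\<alpha> (fm_str \<phi>) | \<phi>. sentence \<phi> \<and> true_in_N \<phi>}"
  assume T: "arithmetical ?T"
  from assms have inj: "inj_on \<alpha> Astar"
    by (simp add: computable_simulation_def numbering_def)
  from assms have "partial_recursive 2 (conc \<alpha>)"
    by (simp add: computable_simulation_def recursive_def)
  then obtain c where c: "\<And>xs y. length xs = 2 \<Longrightarrow> computes c xs y \<longleftrightarrow> conc \<alpha> xs = Some y"
    unfolding partial_recursive_def by blast
  \<comment> \<open>Injectivity on \<open>Astar\<close> lets \<open>inv_into\<close> recover
    \<open>u\<close> and \<open>v\<close> from their codes.\<close>
  have conc: "computes c [\<alpha> u, \<alpha> v] y \<longleftrightarrow> y = \<alpha> (u @ v)" if "u \<noteq> []" "v \<noteq> []" for u v y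
    using that c[of "[\<alpha> u, \<alpha> v]" y] inj by (auto simp: conc_def Astar_def)
  have num: "computes (iterate_conc c) [n, \<alpha> [SZero], \<alpha> [SSuc]] y \<longleftrightarrow>
      y = \<alpha> (tm_str (numeral_tm n))" for n y
    by (rule computes_iterate_conc) (rule conc)
  \<comment> \<open>For \<open>n\<close> the code of a formula, the chain yields the code of its
    instance at \<open>n\<close>, and \<open>D n\<close> says that this is not the code of a true
    sentence. The codes of the fixed strings are constants, so \<alpha> itself need not be defined
    by a formula.\<close>
  define D where "D n \<longleftrightarrow> (\<exists>y1 y2 y3 y4 y.
      computes (iterate_conc c) [n, \<alpha> [SZero], \<alpha> [SSuc]] y1 \<and>
      computes c [\<alpha> prefix_str, y1] y2 \<and> computes c [y2, \<alpha> middle_str] y3 \<and>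
      computes c [y3, n] y4 \<and> computes c [y4, \<alpha> [SRpar]] y \<and> \<not> y \<in> ?T)" for n
  have "definable (\<lambda>e. D (e 0))"
    unfolding D_def
    by (intro definable_ex definable_conj definable_computes2 definable_computes3 definable_not
        definable_arithmetical[OF T] is_term_intros)
  then obtain \<delta> where fv: "free_vars \<delta> \<subseteq> {0}" and \<delta>: "\<And>e. sat e \<delta> \<longleftrightarrow> D (e 0)"
    using definable_unary_formula by blast
  define n where "n = \<alpha> (fm_str \<delta>)"
  define \<chi> where "\<chi> = instance_fm \<delta> n"
  have "D n \<longleftrightarrow> \<alpha> (fm_str \<chi>) \<notin> ?T"
    unfolding D_def \<chi>_def instance_str
    by (simp add: n_def num conc tm_str_nonempty fm_str_nonempty del: mem_Collect_eq)
  \<comment> \<open>Injectivity of \<alpha> and unique readability ensure that no other formula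
    shares the code of \<chi>.\<close>
  also have "\<alpha> (fm_str \<chi>) \<in> ?T \<longleftrightarrow> true_in_N \<chi>"
  proof
    assume "\<alpha> (fm_str \<chi>) \<in> ?T"
    then obtain \<phi> where "\<alpha> (fm_str \<chi>) = \<alpha> (fm_str \<phi>)" "true_in_N \<phi>" by blast
    moreover have "fm_str \<chi> \<in> Astar" "fm_str \<phi> \<in> Astar"
      by (simp_all add: Astar_def fm_str_nonempty)
    ultimately show "true_in_N \<chi>" using inj fm_str_inj by (metis inj_onD injD)
  next
    assume "true_in_N \<chi>"
    moreover have "sentence \<chi>" unfolding \<chi>_def by (rule sentence_instance[OF fv])
    ultimately show "\<alpha> (fm_str \<chi>) \<in> ?T" by blast
  qed
  \<comment> \<open>By \<open>sat_instance\<close>, \<chi> holds in an environment exactly if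
    \<delta> does with entry 0 set to \<open>n\<close>. The chain thus makes \<open>D n\<close>
    equivalent to its own negation.\<close>
  also have "true_in_N \<chi> \<longleftrightarrow> D n"
    by (simp add: true_in_N_def \<chi>_def sat_instance \<delta>)
  finally show False by blast
qed

end
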